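(* Let $n\ge 4$ be an integer and let $QD_{2^n}=\langle a,b : a^{2^{n-1}}=b^2=1,\ bab^{-1}=a^{2^{n-2}-1}\rangle$ be the quasidihedral group of order $2^n$. Let $\Gamma_{QD_{2^n}}$ be its non-commuting graph. Then the spectrum of the distance matrix $D(\Gamma_{QD_{2^n}})$ (eigenvalues counted with multiplicity, multiplicities being added if two of the listed values coincide) consists of: (a) $-2$ with multiplicity $3\cdot 2^{n-2}-3$; (b) $0$ with multiplicity $2^{n-2}-1$; (c) $3(2^{n-2}-1)+\sqrt{5(2^{n-2})^2-10(2^{n-2})+9}$ and $3(2^{n-2}-1)-\sqrt{5(2^{n-2})^2-10(2^{n-2})+9}$, each with multiplicity $1$.
   Context: For a finite non-abelian group $G$ with centre $Z(G)$, the non-commuting graph $\Gamma_G$ is the simple undirected graph with vertex set $G\setminus Z(G)$, in which two distinct vertices $u,v$ are adjacent if and only if $uv\ne vu$. For a connected graph $H$, $d_{uv}$ denotes the length of a shortest path between vertices $u$ and $v$, and the distance matrix $D(H)$ is the matrix whose $(u,v)$-entry is $d_{uv}$. *)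

theory Defs
  imports "HOL-Algebra.Generated_Groups" "Jordan_Normal_Form.Char_Poly"
begin

definition group_centre :: "('a, 'b) monoid_scheme \<Rightarrow> 'a set" where
  "group_centre G = {z \<in> carrier G. \<forall>g \<in> carrier G. z \<otimes>\<^bsub>G\<^esub> g = g \<otimes>\<^bsub>G\<^esub> z}"

definition nc_vertices :: "('a, 'b) monoid_scheme \<Rightarrow> 'a set" where
  "nc_vertices G = carrier G - group_centre G"

definition nc_adj :: "('a, 'b) monoid_scheme \<Rightarrow> 'a \<Rightarrow> 'a \<Rightarrow> bool" where
  "nc_adj G u v \<longleftrightarrow> u \<in> nc_vertices G \<and> v \<in> nc_vertices G \<and> u \<noteq> v
      \<and> u \<otimes>\<^bsub>G\<^esub> v \<noteq> v \<otimes>\<^bsub>G\<^esub> u"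

definition nc_walk :: "('a, 'b) monoid_scheme \<Rightarrow> nat \<Rightarrow> 'a \<Rightarrow> 'a \<Rightarrow> bool" where
  "nc_walk G k u v \<longleftrightarrow> (\<exists>p :: nat \<Rightarrow> 'a. p 0 = u \<and> p k = v \<and>
      (\<forall>i<k. nc_adj G (p i) (p (Suc i))))"

(* graph distance = length of a shortest path (= shortest walk) *)
definition nc_dist :: "('a, 'b) monoid_scheme \<Rightarrow> 'a \<Rightarrow> 'a \<Rightarrow> nat" where
  "nc_dist G u v = (LEAST k. nc_walk G k u v)"

(* distance matrix w.r.t. an enumeration vs of the vertex set *)
definition nc_distance_matrix :: "('a, 'b) monoid_scheme \<Rightarrow> 'a list \<Rightarrow> real mat" where
  "nc_distance_matrix G vs =
     mat (length vs) (length vs) (\<lambda>(i, j). real (nc_dist G (vs ! i) (vs ! j)))"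

end

theory Submission
  imports Defs "HOL-Algebra.Multiplicative_Group"
begin

text \<open>
  Put \<open>m = 2^(n - 2)\<close>. Commuting is an equivalence relation on the non-central elements: the
  \<open>2 m - 2\<close> non-central powers of \<open>a\<close> form one class and the reflections \<open>a^i b\<close> fall into the
  \<open>m\<close> classes \<open>{a^i b, a^(i + m) b}\<close>. Hence the graph is complete multipartite, and distances are
  2 inside a class and 1 between classes. Differences of basis vectors yield the eigenvalues
  \<open>-2\<close> and 0, and what remains is the action on the quotient, a \<open>2 \<times> 2\<close> matrix with trace
  \<open>6 (m - 1)\<close> and determinant \<open>4 m (m - 2)\<close>.
\<close>

section \<open>Characteristic polynomials\<close>

text \<open>An invertible \<open>P\<close> makes the intertwining relation a similarity. In this
  form, later uses need only a nonzero determinant, never an explicit inverse.\<close>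

lemma char_poly_eqI_intertwining:
  fixes A B P :: "'a :: field mat"
  assumes A: "A \<in> carrier_mat N N" and B: "B \<in> carrier_mat N N" and P: "P \<in> carrier_mat N N"
    and det: "det P \<noteq> 0" and eq: "A * P = P * B"
  shows "char_poly A = char_poly B"
proof -
  from det_non_zero_imp_unit[OF P det, unfolded Units_def ring_mat_def, of "()"]
  obtain Q where Q: "Q \<in> carrier_mat N N" and "Q * P = 1\<^sub>m N" "P * Q = 1\<^sub>m N"
    by auto
  have "A = A * (P * Q)" using A by (simp add: \<open>P * Q = _\<close>)
  also have "\<dots> = A * P * Q" by (rule assoc_mult_mat[symmetric, OF A P Q])
  finally have "A = P * B * Q" using eq by simp
  with A B P Q \<open>Q * P = _\<close> \<open>P * Q = _\<close> have "similar_mat A B"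
    by (intro similar_matI[of _ _ P Q N]) auto
  then show ?thesis by (rule char_poly_similar)
qed

lemma mult_mat_eqI:
  assumes "\<And>i j. i < N \<Longrightarrow> j < N \<Longrightarrow> (\<Sum>l<N. f i l * g l j) = (\<Sum>l<N. f' i l * g' l j)"
  shows "mat N N (\<lambda>(i, j). f i j) * mat N N (\<lambda>(i, j). g i j)
    = mat N N (\<lambda>(i, j). f' i j) * mat N N (\<lambda>(i, j). g' i j)"
  using assms by (intro eq_matI) (simp_all add: scalar_prod_def lessThan_atLeast0)

text \<open>Two enumerations of the same set differ by a permutation matrix, so the spectrum may be
  computed in any convenient order.\<close>

lemma char_poly_reindex:
  fixes d :: "'a \<Rightarrow> 'a \<Rightarrow> 'b :: field"
  assumes "distinct vs" "distinct ws" "set vs = set ws"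
  shows "char_poly (mat (length vs) (length vs) (\<lambda>(i, j). d (vs ! i) (vs ! j)))
    = char_poly (mat (length ws) (length ws) (\<lambda>(i, j). d (ws ! i) (ws ! j)))"
proof -
  let ?N = "length vs"
  have len: "length ws = ?N" using assms by (metis distinct_card)
  have mem: "vs ! i \<in> set ws" "ws ! i \<in> set vs" if "i < ?N" for i
    using that len assms(3) nth_mem by metis+
  define P :: "'b mat" where "P = mat ?N ?N (\<lambda>(i, j). of_bool (vs ! i = ws ! j))"
  have pick: "(\<Sum>l<length us. f (us ! l) * of_bool (us ! l = v)) = f v"
    if "distinct us" "v \<in> set us" for us and v :: 'a and f :: "'a \<Rightarrow> 'b"
  proof -
    have "(\<Sum>l<length us. f (us ! l) * of_bool (us ! l = v)) = (\<Sum>u\<in>set us. f u * of_bool (u = v))"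
      by (rule sum.reindex_bij_betw[OF bij_betw_nth[OF that(1) refl refl]])
    also have "\<dots> = f v"
      using that(2) by (simp add: of_bool_def if_distrib sum.delta cong: if_cong)
    finally show ?thesis .
  qed
  have pick': "(\<Sum>l<length us. of_bool (v = us ! l) * f (us ! l)) = f v"
    if "distinct us" "v \<in> set us" for us and v :: 'a and f :: "'a \<Rightarrow> 'b"
    using pick[OF that, of f] by (simp add: mult.commute eq_commute)
  \<comment> \<open>Orthogonality of the permutation matrix gives a nonzero determinant without
    computing a sign.\<close>
  have "P * transpose_mat P = 1\<^sub>m ?N"
  proof (rule eq_matI)
    fix i j assume ij: "i < dim_row (1\<^sub>m ?N)" "j < dim_col (1\<^sub>m ?N)"
    then have "(P * transpose_mat P) $$ (i, j)
      = (\<Sum>l<length ws. of_bool (vs ! i = ws ! l) * of_bool (vs ! j = ws ! l))"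
      by (simp add: P_def scalar_prod_def lessThan_atLeast0 len)
    also have "\<dots> = of_bool (vs ! j = vs ! i)"
      by (rule pick'[of ws "vs ! i" "\<lambda>u. of_bool (vs ! j = u)"]) (use ij mem assms(2) in simp_all)
    finally show "(P * transpose_mat P) $$ (i, j) = 1\<^sub>m ?N $$ (i, j)"
      using ij nth_eq_iff_index_eq[OF assms(1), of j i] by simp
  qed (simp_all add: P_def)
  then have "det P * det (transpose_mat P) = 1"
    using det_mult[of P ?N "transpose_mat P"] by (simp add: P_def)
  then have "det P \<noteq> 0" by auto
  moreover have "mat ?N ?N (\<lambda>(i, j). d (vs ! i) (vs ! j)) * P
      = P * mat ?N ?N (\<lambda>(i, j). d (ws ! i) (ws ! j))"
    unfolding P_def
  proof (rule mult_mat_eqI)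
    fix i j assume ij: "i < ?N" "j < ?N"
    have "(\<Sum>l<?N. d (vs ! i) (vs ! l) * of_bool (vs ! l = ws ! j)) = d (vs ! i) (ws ! j)"
      by (rule pick) (use assms(1) ij mem in simp_all)
    moreover have "(\<Sum>l<?N. of_bool (vs ! i = ws ! l) * d (ws ! l) (ws ! j)) = d (vs ! i) (ws ! j)"
      using pick'[of ws "vs ! i" "\<lambda>u. d u (ws ! j)"] assms(2) ij mem len by simp
    ultimately show "(\<Sum>l<?N. d (vs ! i) (vs ! l) * of_bool (vs ! l = ws ! j)) =
      (\<Sum>l<?N. of_bool (vs ! i = ws ! l) * d (ws ! l) (ws ! j))" by simp
  qed
  ultimately show ?thesis unfolding len
    by (rule char_poly_eqI_intertwining[of _ ?N _ P, rotated 3]) (simp_all add: P_def)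
qed

lemma char_poly_four_block_lower:
  fixes A :: "'a :: idom mat"
  assumes A: "A \<in> carrier_mat n n" and C: "C \<in> carrier_mat m n" and D: "D \<in> carrier_mat m m"
  shows "char_poly (four_block_mat A (0\<^sub>m n m) C D) = char_poly A * char_poly D"
proof -
  have "char_poly_matrix (four_block_mat A (0\<^sub>m n m) C D)
    = four_block_mat (char_poly_matrix A) (0\<^sub>m n m) (map_mat (\<lambda>a. [:- a:]) C) (char_poly_matrix D)"
    by (rule eq_matI, insert A C D, auto simp: char_poly_matrix_def)
  then show ?thesis unfolding char_poly_def
    using A C D by (simp add: det_four_block_mat_upper_right_zero[of _ n _ m])
qed

text \<open>The matrix is cut into four blocks of size 1; these commute, so the block determinant
  formula applies.\<close>

lemma char_poly_mat_2:
  "char_poly (mat 2 2 (\<lambda>(i, j). f i j)) =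
    [:f 0 0 * f 1 1 - f 0 1 * f 1 0, - (f 0 0 + f 1 1), 1 :: 'a :: idom:]"
proof -
  have split: "det (four_block_mat (mat 1 1 (\<lambda>_. a)) (mat 1 1 (\<lambda>_. b)) (mat 1 1 (\<lambda>_. c)) (mat 1 1 (\<lambda>_. d)))
     = a * d - b * c" for a b c d :: "'a poly"
  proof -
    have "det (four_block_mat (mat 1 1 (\<lambda>_. a)) (mat 1 1 (\<lambda>_. b)) (mat 1 1 (\<lambda>_. c)) (mat 1 1 (\<lambda>_. d)))
      = det (mat 1 1 (\<lambda>_. a) * mat 1 1 (\<lambda>_. d) - mat 1 1 (\<lambda>_. b) * mat 1 1 (\<lambda>_. c))"
      by (rule det_four_block_mat[of _ 1]) (auto simp: scalar_prod_def mult.commute intro!: eq_matI)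
    also have "mat 1 1 (\<lambda>_. a) * mat 1 1 (\<lambda>_. d) - mat 1 1 (\<lambda>_. b) * mat 1 1 (\<lambda>_. c)
      = mat 1 1 (\<lambda>_. a * d - b * c)"
      by (rule eq_matI) (auto simp: scalar_prod_def)
    finally show ?thesis by (simp add: det_single[of "mat 1 1 _"] del: One_nat_def)
  qed
  have "char_poly_matrix (mat 2 2 (\<lambda>(i, j). f i j)) = four_block_mat
    (mat 1 1 (\<lambda>_. [:- f 0 0, 1:])) (mat 1 1 (\<lambda>_. [:- f 0 1:]))
    (mat 1 1 (\<lambda>_. [:- f 1 0:])) (mat 1 1 (\<lambda>_. [:- f 1 1, 1:]))"
    by (rule eq_matI) (auto simp: char_poly_matrix_def less_Suc_eq numeral_2_eq_2)
  then show ?thesis unfolding char_poly_def by (simp only: split) (simp add: algebra_simps)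
qed

lemma prod_diag_mat:
  "(\<Prod>a\<leftarrow>diag_mat (mat N N (\<lambda>(i, j). f i j)). g a) = (\<Prod>i<N. g (f i i))"
proof -
  have "map g (diag_mat (mat N N (\<lambda>(i, j). f i j))) = map (\<lambda>i. g (f i i)) [0..<N]"
    by (simp add: diag_mat_def)
  then show ?thesis
    using prod.distinct_set_conv_list[of "[0..<N]" "\<lambda>i. g (f i i)"] by (simp add: lessThan_atLeast0)
qed

section \<open>Complete multipartite graphs with one large part\<close>

text \<open>
  Indexing of a complete multipartite graph with one part of size \<open>k\<close> and \<open>m\<close> parts of size 2:
  the big part is \<open>{0} \<union> {2..k}\<close> and the pairs are \<open>{1, k + m}\<close> and \<open>{k + p, k + m + p}\<close> for
  \<open>0 < p < m\<close>. Representatives of the two kinds of parts sit at the indices 0 and 1, so that the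
  quotient \<open>2 \<times> 2\<close> block ends up in the upper left corner.
\<close>

definition pair_part :: "nat \<Rightarrow> nat \<Rightarrow> nat \<Rightarrow> nat" where
  "pair_part k m i = (if i = 0 then 0 else if i = 1 then 1 else if i \<le> k then 0
     else if i < k + m then Suc (i - k) else Suc (i - k - m))"

text \<open>The path metric of a complete multipartite graph with at least two parts, the parts
  being the fibres of \<open>c\<close>.\<close>

definition multipartite_dist :: "('a \<Rightarrow> 'b) \<Rightarrow> 'a \<Rightarrow> 'a \<Rightarrow> nat" where
  "multipartite_dist c u v = (if u = v then 0 else if c u = c v then 2 else 1)"

text \<open>
  The new basis consists of the unit vectors \<open>e 0\<close>, \<open>e 1\<close> and \<open>e j - e (base_index j)\<close> for
  \<open>j \<ge> 2\<close>. As \<open>base_index j < j\<close>, the base change is unitriangular, and since the coordinate sums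
  over the big part and over the union of the pairs vanish on the vectors with \<open>j \<ge> 2\<close>, their span
  is invariant.
\<close>

definition base_index :: "nat \<Rightarrow> nat \<Rightarrow> nat \<Rightarrow> nat" where
  "base_index k m j = (if j \<le> k then 0 else if j \<le> k + m then 1 else j - m)"

definition base_change :: "nat \<Rightarrow> nat \<Rightarrow> nat \<Rightarrow> nat \<Rightarrow> real" where
  "base_change k m i j = of_bool (i = j) - of_bool (2 \<le> j \<and> i = base_index k m j)"

text \<open>Column \<open>j\<close> holds the coordinates, in the new basis, of the distance matrix
  applied to basis vector \<open>j\<close>. In rows 0 and 1 these are the coordinate sums over the
  big part and over the union of the pairs.\<close>

definition reduced :: "nat \<Rightarrow> nat \<Rightarrow> nat \<Rightarrow> nat \<Rightarrow> real" where
  "reduced k m i j =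
    (if j = 0 then (if i = 0 then 2 * real k - 2 else if i = 1 then 2 * real m else if i < k + m then 2 else 1)
     else if j = 1 then (if i = 0 then real k else if i = 1 then 2 * real m else if i \<le> k then 1
        else if i \<le> k + m then 2 else 1)
     else if k < j \<and> j < k + m then of_bool (i = j + m) - of_bool (i = k + m)
     else - 2 * of_bool (i = j))"

lemma sum_mult_of_bool_eq:
  fixes f :: "nat \<Rightarrow> real"
  assumes "a < N"
  shows "(\<Sum>l<N. f l * of_bool (l = a)) = f a" "(\<Sum>l<N. of_bool (a = l) * f l) = f a"
  using assms by (simp_all add: of_bool_def if_distrib if_distribR sum.delta sum.delta' cong: if_cong)

lemma sum_mult_base_change:
  assumes "k \<ge> 1" "m \<ge> 1" "j < k + 2 * m"
  shows "(\<Sum>l<k + 2 * m. f l * base_change k m l j) = f j - (if 2 \<le> j then f (base_index k m j) else 0)"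
proof (cases "2 \<le> j")
  case True
  have "base_index k m j < k + 2 * m" using assms by (auto simp: base_index_def)
  then show ?thesis using assms True
    by (simp add: base_change_def right_diff_distrib sum_subtractf sum_mult_of_bool_eq)
qed (use assms in \<open>simp add: base_change_def sum_mult_of_bool_eq\<close>)

text \<open>Row \<open>i\<close> of the base change has its entries -1 exactly on the fibre of
  \<open>base_index\<close> over \<open>i\<close>, made explicit in
  \<open>base_index_fibre\<close>.\<close>

lemma sum_base_change_mult:
  assumes "k \<ge> 1" "m \<ge> 1" "i < k + 2 * m"
  shows "(\<Sum>l<k + 2 * m. base_change k m i l * f l)
     = f i - (\<Sum>l \<in> {l \<in> {2..<k + 2 * m}. base_index k m l = i}. f l)"
proof -
  have "(\<Sum>l \<in> {l \<in> {2..<k + 2 * m}. base_index k m l = i}. f l)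
     = (\<Sum>l<k + 2 * m. of_bool (2 \<le> l \<and> i = base_index k m l) * f l)"
    by (rule sum.mono_neutral_cong_left) auto
  then show ?thesis using assms
    by (simp add: base_change_def left_diff_distrib sum_subtractf sum_mult_of_bool_eq)
qed

lemma base_index_fibre:
  assumes "k \<ge> 1" "m \<ge> 1" "i < k + 2 * m"
  shows "{l \<in> {2..<k + 2 * m}. base_index k m l = i} =
    (if i = 0 then {2..k} else if i = 1 then {max 2 (k + 1)..k + m}
     else if k < i \<and> i < k + m then {i + m} else {})"
  using assms by (auto simp: base_index_def split: if_splits)

text \<open>The distance matrix is the all-ones matrix plus the same-part indicator minus twice the
  identity. It scales a difference within one part by -2. For \<open>k < j < k + m\<close> it sends
  \<open>e j - e 1\<close> to \<open>(e (j + m) - e j) - (e (k + m) - e 1)\<close>, a difference of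
  the basis vectors \<open>j + m\<close> and \<open>k + m\<close>.\<close>

lemma reduced_relation:
  assumes k: "k \<ge> 1" and m: "m \<ge> 1" and i: "i < k + 2 * m" and j: "j < k + 2 * m"
  shows "(\<Sum>l<k + 2 * m. real (multipartite_dist (pair_part k m) i l) * base_change k m l j)
    = (\<Sum>l<k + 2 * m. base_change k m i l * reduced k m l j)"
proof -
  consider "j = 0" | "j = 1" | "j \<ge> 2" by linarith
  then show ?thesis
  proof cases
    case 1
    have "(\<Sum>l \<in> {2..k}. reduced k m l 0) = 2 * (real k - 1)"
      using k m by (simp add: reduced_def)
    moreover have "(\<Sum>l \<in> {max 2 (k + 1)..k + m}. reduced k m l 0) = 2 * real m - 1"
    proof -
      \<comment> \<open>The coefficient is 2 below \<open>k + m\<close>, where it collects both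
        members of a pair, but 1 at \<open>k + m\<close>, whose partner 1 is itself a basis
        index.\<close>
      have "{max 2 (k + 1)..k + m} = insert (k + m) {k + 1..<k + m}" using k m by auto
      then show ?thesis using k m by (simp add: reduced_def of_nat_diff)
    qed
    ultimately show ?thesis
      unfolding sum_mult_base_change[OF k m j] sum_base_change_mult[OF k m i] base_index_fibre[OF k m i]
      using 1 k m i by (auto simp: reduced_def multipartite_dist_def pair_part_def)
  next
    case 2
    have "(\<Sum>l \<in> {2..k}. reduced k m l 1) = real k - 1"
      using k m by (simp add: reduced_def)
    moreover have "(\<Sum>l \<in> {max 2 (k + 1)..k + m}. reduced k m l 1) = 2 * real m"
      using k m by (simp add: reduced_def)
    ultimately show ?thesis
      unfolding sum_mult_base_change[OF k m j] sum_base_change_mult[OF k m i] base_index_fibre[OF k m i]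
      using 2 k m i by (auto simp: reduced_def multipartite_dist_def pair_part_def)
  next
    case 3
    show ?thesis
    proof (cases "k < j \<and> j < k + m")
      case True
      then have "(\<Sum>l<k + 2 * m. base_change k m i l * reduced k m l j)
        = base_change k m i (j + m) - base_change k m i (k + m)"
        using 3 m by (simp add: reduced_def right_diff_distrib sum_subtractf sum_mult_of_bool_eq)
      then show ?thesis unfolding sum_mult_base_change[OF k m j]
        using True 3 i j k m
        by (auto simp: base_change_def base_index_def multipartite_dist_def pair_part_def)
    next
      case False
      then have "(\<Sum>l<k + 2 * m. base_change k m i l * reduced k m l j)
        = - 2 * base_change k m i j"
        using 3 j sum_mult_of_bool_eq[of j "k+2*m" "base_change k m i"]
        by (auto simp: reduced_def sum_negf simp flip: sum_distrib_left mult.assoc)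
      then show ?thesis unfolding sum_mult_base_change[OF k m j]
        using False 3 i j k m
        by (auto simp: base_change_def base_index_def multipartite_dist_def pair_part_def)
    qed
  qed
qed

text \<open>Rows 0 and 1 vanish in the columns from 2 on, which splits off the quotient block. The
  rest is lower triangular with diagonal entries -2 and 0.\<close>

lemma char_poly_reduced:
  assumes k: "k \<ge> 1" and m: "m \<ge> 1"
  shows "char_poly (mat (k + 2 * m) (k + 2 * m) (\<lambda>(i, j). reduced k m i j)) =
    [:2 * real m * (real k - 2), - (2 * real k + 2 * real m - 2), 1:]
      * ([:2, 1:] ^ (k + m - 1) * [:0, 1:] ^ (m - 1))"
proof -
  define M where "M = k + 2 * m - 2"
  have N: "k + 2 * m = 2 + M" using k m by (simp add: M_def)
  define A where "A = mat 2 2 (\<lambda>(i, j). reduced k m i j)"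
  define C where "C = mat M 2 (\<lambda>(i, j). reduced k m (i + 2) j)"
  define L where "L = mat M M (\<lambda>(i, j). reduced k m (i + 2) (j + 2))"
  have "mat (k + 2 * m) (k + 2 * m) (\<lambda>(i, j). reduced k m i j) = four_block_mat A (0\<^sub>m 2 M) C L"
  proof (rule eq_matI)
    have zero: "reduced k m i j = 0" if "i < 2" "2 \<le> j" for i j
      using that k m by (auto simp: reduced_def)
    fix i j
    assume "i < dim_row (four_block_mat A (0\<^sub>m 2 M) C L)" "j < dim_col (four_block_mat A (0\<^sub>m 2 M) C L)"
    then have i: "i < 2 + M" and j: "j < 2 + M" by (simp_all add: A_def L_def)
    show "mat (k + 2 * m) (k + 2 * m) (\<lambda>(i, j). reduced k m i j) $$ (i, j)
        = four_block_mat A (0\<^sub>m 2 M) C L $$ (i, j)"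
    proof (cases "i < 2"; cases "j < 2")
      assume "\<not> i < 2" "j < 2"
      then obtain i' where "i = i' + 2" using le_iff_add[of 2 i] by (auto simp: add.commute)
      with \<open>j < 2\<close> i j show ?thesis by (simp add: A_def C_def L_def N)
    next
      assume "\<not> i < 2" "\<not> j < 2"
      then obtain i' j' where "i = i' + 2" "j = j' + 2"
        using le_iff_add[of 2 i] le_iff_add[of 2 j] by (auto simp: add.commute)
      with i j show ?thesis by (simp add: A_def C_def L_def N)
    qed (use i j in \<open>simp_all add: A_def C_def L_def N zero\<close>)
  qed (simp_all add: A_def L_def N)
  then have "char_poly (mat (k + 2 * m) (k + 2 * m) (\<lambda>(i, j). reduced k m i j)) = char_poly A * char_poly L"
    by (simp add: char_poly_four_block_lower A_def C_def L_def)
  also have "char_poly A = [:2 * real m * (real k - 2), - (2 * real k + 2 * real m - 2), 1:]"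
    unfolding A_def char_poly_mat_2 by (simp add: reduced_def algebra_simps)
  also have "char_poly L = [:2, 1:] ^ (k + m - 1) * [:0, 1:] ^ (m - 1)"
  proof -
    \<comment> \<open>A column with \<open>k < j < k + m\<close> has entries only in the later rows
      \<open>j + m\<close> and \<open>k + m\<close>; the other columns are diagonal.\<close>
    have "upper_triangular (transpose_mat L)"
      using k m by (intro upper_triangularI) (auto simp: L_def reduced_def)
    moreover have T: "transpose_mat L = mat M M (\<lambda>(i, j). reduced k m (j + 2) (i + 2))"
      by (rule eq_matI) (simp_all add: L_def)
    ultimately have "char_poly (transpose_mat L) = (\<Prod>i<M. [:- reduced k m (i + 2) (i + 2), 1:])"
      by (subst char_poly_upper_triangular[of _ M]) (simp_all only: T prod_diag_mat mat_carrier)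
    also have "\<dots> = (\<Prod>i\<in>{2..<k + 2 * m}. [:- reduced k m i i, 1:])"
      unfolding N
      by (rule prod.reindex_bij_witness[of _ "\<lambda>i. i - 2" "\<lambda>i. i + 2"]) auto
    also have "{2..<k + 2 * m} = ({2..k} \<union> {max 2 (k + m)..<k + 2 * m}) \<union> {k + 1..<k + m}"
      using k m by auto
    also have "(\<Prod>i\<in>\<dots>. [:- reduced k m i i, 1:])
       = (\<Prod>i\<in>{2..k} \<union> {max 2 (k + m)..<k + 2 * m}. [:- reduced k m i i, 1:])
         * (\<Prod>i\<in>{k + 1..<k + m}. [:- reduced k m i i, 1:])"
      by (rule prod.union_disjoint) auto
    also have "(\<Prod>i\<in>{2..k} \<union> {max 2 (k + m)..<k + 2 * m}. [:- reduced k m i i, 1:])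
       = (\<Prod>i\<in>{2..k} \<union> {max 2 (k + m)..<k + 2 * m}. [:2, 1:])"
      by (rule prod.cong) (auto simp: reduced_def)
    also have "(\<Prod>i\<in>{k + 1..<k + m}. [:- reduced k m i i, 1:]) = (\<Prod>i\<in>{k + 1..<k + m}. [:0, 1:])"
      using k m by (intro prod.cong) (auto simp: reduced_def)
    also have "(\<Prod>i\<in>{2..k} \<union> {max 2 (k + m)..<k + 2 * m}. [:2, 1:])
         * (\<Prod>i\<in>{k + 1..<k + m}. [:0, 1:])
      = [:2, 1:] ^ (k + m - 1) * [:0, 1 :: real:] ^ (m - 1)"
    proof -
      have "card ({2..k} \<union> {max 2 (k + m)..<k + 2 * m}) = k + m - 1"
        using k m by (subst card_Un_disjoint) auto
      then show ?thesis by simp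
    qed
    finally show ?thesis by (simp add: L_def char_poly_transpose_mat[of _ M])
  qed
  finally show ?thesis .
qed

lemma char_poly_multipartite:
  assumes k: "k \<ge> 1" and m: "m \<ge> 1"
  shows "char_poly (mat (k + 2 * m) (k + 2 * m)
      (\<lambda>(i, j). real (multipartite_dist (pair_part k m) i j))) =
    [:2 * real m * (real k - 2), - (2 * real k + 2 * real m - 2), 1:]
      * ([:2, 1:] ^ (k + m - 1) * [:0, 1:] ^ (m - 1))"
proof -
  let ?N = "k + 2 * m"
  define P where "P = mat ?N ?N (\<lambda>(i, j). base_change k m i j)"
  have "upper_triangular P"
    by (intro upper_triangularI) (auto simp: P_def base_change_def base_index_def split: if_splits)
  then have "det P = prod_list (diag_mat P)"
    by (rule det_upper_triangular[of P ?N]) (simp add: P_def)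
  also have "\<dots> = (\<Prod>i<?N. base_change k m i i)"
    using prod_diag_mat[of "\<lambda>a. a" ?N] by (simp add: P_def)
  also have "\<dots> = 1"
    using m by (intro prod.neutral) (auto simp: base_change_def base_index_def)
  finally have "det P \<noteq> 0" by simp
  then have "char_poly (mat ?N ?N (\<lambda>(i, j). real (multipartite_dist (pair_part k m) i j)))
     = char_poly (mat ?N ?N (\<lambda>(i, j). reduced k m i j))"
    unfolding P_def
    by (rule char_poly_eqI_intertwining[where N = ?N, rotated 3])
      (rule mult_mat_eqI reduced_relation[OF k m] mat_carrier | assumption)+
  then show ?thesis by (simp only: char_poly_reduced[OF k m])
qed

section \<open>The non-commuting graph of the quasidihedral group\<close>

text \<open>A common neighbour of commuting vertices bounds all distances by 2, so only walks of
  length at most 2 matter.\<close>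

lemma nc_dist_eq:
  assumes u: "u \<in> nc_vertices G" and v: "v \<in> nc_vertices G"
    and w: "u \<otimes>\<^bsub>G\<^esub> v = v \<otimes>\<^bsub>G\<^esub> u \<Longrightarrow> \<exists>w. nc_adj G u w \<and> nc_adj G w v"
  shows "nc_dist G u v = (if u = v then 0 else if u \<otimes>\<^bsub>G\<^esub> v = v \<otimes>\<^bsub>G\<^esub> u then 2 else 1)"
proof -
  have walk0: "nc_walk G 0 u v \<longleftrightarrow> u = v" unfolding nc_walk_def by auto
  have walk1: "nc_walk G 1 u v \<longleftrightarrow> nc_adj G u v" unfolding nc_walk_def
    by (auto intro!: exI[of _ "\<lambda>i. if i = 0 then u else v"])
  have walk2: "nc_walk G 2 u v" if "nc_adj G u x" "nc_adj G x v" for x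
    unfolding nc_walk_def using that
    by (intro exI[of _ "\<lambda>i. if i = 0 then u else if i = 1 then x else v"])
      (auto simp: less_2_cases_iff)
  consider "u = v" | "u \<noteq> v" "u \<otimes>\<^bsub>G\<^esub> v = v \<otimes>\<^bsub>G\<^esub> u" | "u \<otimes>\<^bsub>G\<^esub> v \<noteq> v \<otimes>\<^bsub>G\<^esub> u" by auto
  then show ?thesis
  proof cases
    case 1
    then show ?thesis unfolding nc_dist_def using walk0 by (auto intro!: Least_equality)
  next
    case 2
    then have "\<not> nc_walk G 0 u v" "\<not> nc_walk G 1 u v" unfolding walk0 walk1 by (auto simp: nc_adj_def)
    then have "2 \<le> k" if "nc_walk G k u v" for k
      using that less_2_cases[of k] by (force simp: not_le[symmetric])
    moreover have "nc_walk G 2 u v" using 2 w walk2 by blast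
    ultimately have "nc_dist G u v = 2" unfolding nc_dist_def by (intro Least_equality)
    then show ?thesis using 2 by simp
  next
    case 3
    then have "u \<noteq> v" by auto
    with 3 have "nc_walk G 1 u v" unfolding walk1 using u v by (simp add: nc_adj_def)
    moreover have "1 \<le> k" if "nc_walk G k u v" for k
      using that walk0 \<open>u \<noteq> v\<close> by (cases k) auto
    ultimately have "nc_dist G u v = 1" unfolding nc_dist_def by (intro Least_equality)
    then show ?thesis using 3 \<open>u \<noteq> v\<close> by simp
  qed
qed

text \<open>Here \<open>m\<close> stands for \<open>2^(n - 2)\<close>, so that \<open>a\<close> has order \<open>2 m\<close> and the centre is \<open>{1, a^m}\<close>.\<close>

locale quasidihedral = group G for G (structure) +
  fixes a b :: 'a and m :: nat
  assumes m_pow: "\<exists>e\<ge>2. m = 2 ^ e"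
    and a: "a \<in> carrier G" and b: "b \<in> carrier G"
    and gen: "generate G {a, b} = carrier G"
    and a_pow: "a [^] (2 * m) = \<one>"
    and b_sq: "b \<otimes> b = \<one>"
    and conj: "b \<otimes> a \<otimes> inv b = a [^] (m - 1)"
    and order: "card (carrier G) = 4 * m"
begin

section \<open>Normal forms and the order of \<open>a\<close>\<close>

abbreviation rot :: "int \<Rightarrow> 'a" where "rot i \<equiv> a [^] i"
abbreviation rfl :: "int \<Rightarrow> 'a" where "rfl i \<equiv> a [^] i \<otimes> b"

lemma four_dvd: "4 dvd m"
  using m_pow le_imp_power_dvd[of 2 _ "2::nat"] by auto

lemma m_pos: "m > 0"
  using m_pow by auto

lemma inv_b: "inv b = b"
  using b_sq b by (simp add: inv_equality)

text \<open>Conjugation by \<open>b\<close> is a homomorphism, so the defining relation extends to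
  all integer powers of \<open>a\<close>.\<close>

lemma b_rot: "b \<otimes> rot i = rfl ((int m - 1) * i)"
proof -
  have "b \<otimes> rot i \<otimes> inv b = (b \<otimes> a \<otimes> inv b) [^] i"
  proof -
    have hom: "(\<lambda>x. b \<otimes> x \<otimes> inv b) \<in> hom G G"
      using b by (auto simp: hom_def m_assoc inv_solve_left)
    then interpret group_hom G G "\<lambda>x. b \<otimes> x \<otimes> inv b" by unfold_locales
    show ?thesis using hom_int_pow[of a i] a by simp
  qed
  also have "\<dots> = rot ((int m - 1) * i)"
  proof -
    have "a [^] (m - 1) = rot (int m - 1)"
      using m_pos by (simp add: of_nat_diff flip: int_pow_int)
    then show ?thesis using a conj by (simp add: int_pow_pow)
  qed
  finally have "b \<otimes> rot i \<otimes> inv b \<otimes> b = rfl ((int m - 1) * i)" by simp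
  then show ?thesis using a b by (simp add: m_assoc)
qed

lemma rot_mult: "rot i \<otimes> rot j = rot (i + j)" using a by (simp add: int_pow_mult)

lemma rot_refl: "rot i \<otimes> rfl j = rfl (i + j)"
  using a b by (simp add: int_pow_mult m_assoc)

lemma refl_rot: "rfl i \<otimes> rot j = rfl (i + (int m - 1) * j)"
proof -
  have "rfl i \<otimes> rot j = rot i \<otimes> (b \<otimes> rot j)" using a b by (simp add: m_assoc)
  then show ?thesis unfolding b_rot rot_refl .
qed

lemma refl_refl: "rfl i \<otimes> rfl j = rot (i + (int m - 1) * j)"
proof -
  have "rfl i \<otimes> rfl j = (rfl i \<otimes> rot j) \<otimes> b" using a b by (simp add: m_assoc)
  then show ?thesis unfolding refl_rot using a b b_sq by (simp add: m_assoc)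
qed

text \<open>The generators and their inverses have one of the two forms, and the four product rules
  preserve them.\<close>

lemma carrier_cases: "x \<in> carrier G \<Longrightarrow> (\<exists>i. x = rot i) \<or> (\<exists>i. x = rfl i)"
  unfolding gen[symmetric]
proof (induction rule: generate.induct)
  case one
  have "\<one> = rot 0" by simp
  then show ?case by blast
next
  case (incl h)
  have "a = rot 1" "b = rfl 0" using a b by (simp_all add: int_pow_1)
  with incl show ?case by blast
next
  case (inv h)
  have "inv a = rot (-1)" "inv b = rfl 0" using a b by (simp_all add: int_pow_neg int_pow_1 inv_b)
  with inv show ?case by blast
next
  case (eng x y)
  then show ?case using rot_mult rot_refl refl_rot refl_refl by metis
qed

lemma ord_dvd: "ord a dvd 2 * m" using a_pow a pow_eq_id by blast

lemma rot_mod: "rot i = rot (i mod int (ord a))"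
  using a by (simp add: int_pow_eq flip: mod_eq_dvd_iff) 

lemma rot_image: "range rot = rot ` {0..<int (ord a)}"
proof -
  have "ord a > 0" using ord_dvd m_pos by (auto intro: Nat.gr0I)
  then have "rot i \<in> rot ` {0..<int (ord a)}" for i
    by (subst rot_mod) auto
  then show ?thesis by auto
qed

lemma card_range_rot: "card (range rot) \<le> ord a"
  unfolding rot_image using card_image_le[of "{0..<int (ord a)}" rot] by simp

lemma finite_range_rot: "finite (range rot)" unfolding rot_image by simp

lemma carrier_eq: "carrier G = range rot \<union> (\<lambda>x. x \<otimes> b) ` range rot"
  using carrier_cases a b by fastforce

text \<open>The group is covered by the powers of \<open>a\<close> and their right translates by
  \<open>b\<close>, so \<open>4 * m\<close> is at most twice the order of \<open>a\<close>, which
  divides \<open>2 * m\<close>.\<close>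

lemma ord_a: "ord a = 2 * m"
proof -
  have "4 * m \<le> card (range rot) + card ((\<lambda>x. x \<otimes> b) ` range rot)"
    unfolding order[symmetric] carrier_eq by (rule card_Un_le)
  also have "\<dots> \<le> 2 * card (range rot)" using card_image_le[OF finite_range_rot] by simp
  finally have "2 * m \<le> ord a" using card_range_rot by simp
  moreover have "ord a \<le> 2 * m" using ord_dvd m_pos by (intro dvd_imp_le) auto
  ultimately show ?thesis by simp
qed

lemma rot_eq_iff: "rot i = rot j \<longleftrightarrow> 2 * int m dvd j - i"
  using int_pow_eq[OF a] by (simp add: ord_a)

lemma refl_eq_iff: "rfl i = rfl j \<longleftrightarrow> 2 * int m dvd j - i"
  using a b by (simp add: rot_eq_iff)

text \<open>Otherwise \<open>b\<close> would be a power of \<open>a\<close>, leaving at most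
  \<open>2 * m\<close> elements.\<close>

lemma rot_neq_refl: "rot i \<noteq> rfl j"
proof
  assume "rot i = rfl j"
  then have "b = rot (- j) \<otimes> rot i" using a b by (simp add: int_pow_neg inv_solve_left)
  then have b': "b = rot (i - j)" unfolding rot_mult by simp
  have "rot l \<otimes> b \<in> range rot" for l by (subst b') (simp add: rot_mult)
  then have "carrier G \<subseteq> range rot" unfolding carrier_eq by auto
  then have "4 * m \<le> card (range rot)" unfolding order[symmetric] by (rule card_mono[OF finite_range_rot])
  then show False using card_range_rot ord_a m_pos by simp
qed

text \<open>This is where \<open>n \<ge> 4\<close> enters: \<open>m - 2\<close> is twice an odd number because \<open>4\<close> divides \<open>m\<close>.\<close>

lemma dvd_twist: "2 * int m dvd (int m - 2) * i \<longleftrightarrow> int m dvd i"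
proof -
  obtain h where h: "int m = 4 * h" using four_dvd by (metis dvd_def int_dvd_int_iff of_nat_numeral)
  obtain e where e: "m = 2 ^ e" using m_pow by auto
  have "2 * int m dvd (int m - 2) * i \<longleftrightarrow> 2 * int m dvd 2 * ((2 * h - 1) * i)"
    unfolding h by (simp add: algebra_simps)
  also have "\<dots> \<longleftrightarrow> int m dvd (2 * h - 1) * i" by simp
  also have "\<dots> \<longleftrightarrow> int m dvd i"
    by (rule coprime_dvd_mult_right_iff) (simp add: e)
  finally show ?thesis .
qed

section \<open>Commutation, vertices and distances\<close>

lemma rot_comm: "rot i \<otimes> rot j = rot j \<otimes> rot i" by (simp add: rot_mult add.commute)

text \<open>The exponents of the two products differ by \<open>(m - 2) * i\<close>, to be read
  modulo \<open>2 * m\<close>.\<close>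

lemma rot_refl_comm: "rot i \<otimes> rfl j = rfl j \<otimes> rot i \<longleftrightarrow> int m dvd i"
proof -
  have "rot i \<otimes> rfl j = rfl j \<otimes> rot i \<longleftrightarrow> 2 * int m dvd (int m - 2) * i"
    unfolding rot_refl refl_rot refl_eq_iff by (simp add: algebra_simps)
  then show ?thesis by (simp add: dvd_twist)
qed

lemma refl_refl_comm: "rfl i \<otimes> rfl j = rfl j \<otimes> rfl i \<longleftrightarrow> int m dvd i - j"
proof -
  have "rfl i \<otimes> rfl j = rfl j \<otimes> rfl i \<longleftrightarrow> 2 * int m dvd (int m - 2) * (i - j)"
    unfolding refl_refl rot_eq_iff by (simp add: algebra_simps)
  then show ?thesis by (simp add: dvd_twist)
qed

lemma not_m_dvd_1: "\<not> int m dvd 1" using four_dvd m_pos by auto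

lemma rot_vertex: "rot i \<in> nc_vertices G \<longleftrightarrow> \<not> int m dvd i"
proof
  assume "rot i \<in> nc_vertices G"
  then obtain x where x: "x \<in> carrier G" "rot i \<otimes> x \<noteq> x \<otimes> rot i"
    by (auto simp: nc_vertices_def group_centre_def)
  then obtain j where "x = rfl j" using carrier_cases rot_comm by metis
  with x show "\<not> int m dvd i" by (simp add: rot_refl_comm)
next
  assume "\<not> int m dvd i"
  then have "rot i \<otimes> rfl 0 \<noteq> rfl 0 \<otimes> rot i" unfolding rot_refl_comm .
  then show "rot i \<in> nc_vertices G" using a b unfolding nc_vertices_def group_centre_def by blast
qed

lemma refl_vertex: "rfl i \<in> nc_vertices G"
proof -
  have "rot 1 \<otimes> rfl i \<noteq> rfl i \<otimes> rot 1" unfolding rot_refl_comm by (rule not_m_dvd_1)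
  then show ?thesis using a b unfolding nc_vertices_def group_centre_def
    by (metis (mono_tags, lifting) DiffI int_pow_closed m_closed mem_Collect_eq)
qed

lemma nc_dist_rot_rot:
  assumes "\<not> int m dvd i" "\<not> int m dvd j"
  shows "nc_dist G (rot i) (rot j) = (if rot i = rot j then 0 else 2)"
proof -
  \<comment> \<open>The reflection \<open>b\<close> is a common neighbour of all non-central
    rotations.\<close>
  have "nc_adj G (rot i) (rfl 0)" "nc_adj G (rfl 0) (rot j)"
    unfolding nc_adj_def using assms rot_vertex refl_vertex rot_neq_refl rot_refl_comm by metis+
  then show ?thesis using assms rot_vertex rot_comm by (subst nc_dist_eq) auto
qed

lemma nc_dist_rot_refl:
  assumes "\<not> int m dvd i"
  shows "nc_dist G (rot i) (rfl j) = 1" "nc_dist G (rfl j) (rot i) = 1"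
  using assms rot_vertex refl_vertex rot_neq_refl rot_refl_comm
  by (subst nc_dist_eq; metis)+

lemma nc_dist_refl_refl:
  "nc_dist G (rfl i) (rfl j) = (if rfl i = rfl j then 0 else if int m dvd i - j then 2 else 1)"
proof -
  \<comment> \<open>Dually, \<open>a\<close> is a common neighbour of all reflections.\<close>
  have "nc_adj G (rfl i) (rot 1)" "nc_adj G (rot 1) (rfl j)"
    unfolding nc_adj_def using rot_vertex refl_vertex rot_neq_refl rot_refl_comm not_m_dvd_1 by metis+
  then show ?thesis using refl_vertex refl_refl_comm by (subst nc_dist_eq) auto
qed

section \<open>An explicit enumeration of the vertices\<close>

lemma dvd_diff_iff:
  assumes "0 \<le> x" "x < 2 * int m" "0 \<le> y" "y < 2 * int m"
  shows "int m dvd x - y \<longleftrightarrow> x = y \<or> x = y + int m \<or> y = x + int m"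
    "2 * int m dvd y - x \<longleftrightarrow> x = y"
proof -
  show "int m dvd x - y \<longleftrightarrow> x = y \<or> x = y + int m \<or> y = x + int m"
  proof
    assume "int m dvd x - y"
    then obtain q where q: "x - y = int m * q" by (elim dvdE)
    have "int m * q < int m * 2" "int m * (-2) < int m * q" using assms q by linarith+
    then have "q < 2" "-2 < q" using m_pos unfolding mult_less_cancel_left by auto
    then have "q = -1 \<or> q = 0 \<or> q = 1" by auto
    then show "x = y \<or> x = y + int m \<or> y = x + int m" using q by auto
  qed (auto simp: algebra_simps)
  show "2 * int m dvd y - x \<longleftrightarrow> x = y"
    using assms zdvd_not_zless[of "y - x" "2 * int m"] zdvd_not_zless[of "x - y" "2 * int m"]
    by (cases x y rule: linorder_cases) (auto simp: dvd_diff_commute)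
qed

text \<open>
  The enumeration matches \<open>pair_part\<close> with \<open>k = 2 m - 2\<close>: rotations \<open>a^i\<close> with \<open>i\<close> not divisible by
  \<open>m\<close> form the big part, and each reflection is paired with its product by \<open>a^m\<close>.
\<close>

definition expo :: "nat \<Rightarrow> int" where
  "expo i = (if i = 0 then 1 else if i = 1 then 0
     else if i < m then int i else if i \<le> 2 * m - 2 then int i + 1 else int i - int (2 * m - 2))"

definition vertex :: "nat \<Rightarrow> 'a" where
  "vertex i = (if i = 0 \<or> 2 \<le> i \<and> i \<le> 2 * m - 2 then rot (expo i) else rfl (expo i))"

abbreviation vertex_count :: nat where "vertex_count \<equiv> (2 * m - 2) + 2 * m"

lemma m_ge_4: "m \<ge> 4" using four_dvd m_pos by (auto dest: dvd_imp_le)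

lemma expo_bounds: "i < vertex_count \<Longrightarrow> 0 \<le> expo i" "i < vertex_count \<Longrightarrow> expo i < 2 * int m"
  using m_ge_4 by (auto simp: expo_def)

text \<open>Rotation indices from \<open>m\<close> on carry their exponent shifted by one, which
  skips the central \<open>a^m\<close>.\<close>

lemma expo_rot:
  assumes "i = 0 \<or> 2 \<le> i \<and> i \<le> 2 * m - 2"
  shows "\<not> int m dvd expo i"
proof -
  have "0 < expo i" "expo i < 2 * int m" "expo i \<noteq> int m" using assms m_ge_4 by (auto simp: expo_def)
  then show ?thesis using dvd_diff_iff(1)[of "expo i" 0] m_pos by auto
qed

text \<open>On reflections the part number is one plus the exponent modulo \<open>m\<close>; part 0
  is reserved for the rotations.\<close>

lemma pair_part_expo:
  assumes "i < vertex_count" "\<not> (i = 0 \<or> 2 \<le> i \<and> i \<le> 2 * m - 2)"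
  shows "int (pair_part (2 * m - 2) m i) = 1 + (if expo i < int m then expo i else expo i - int m)"
proof (cases "i = 1")
  case False
  with assms have "i > 2 * m - 2" by linarith
  then show ?thesis using m_ge_4 by (auto simp: pair_part_def expo_def)
qed (use m_ge_4 in \<open>simp add: pair_part_def expo_def\<close>)

lemma vertex_inj: "inj_on vertex {..<vertex_count}"
proof (rule inj_onI)
  fix i j assume ij: "i \<in> {..<vertex_count}" "j \<in> {..<vertex_count}" and eq: "vertex i = vertex j"
  define R where "R i \<longleftrightarrow> i = 0 \<or> 2 \<le> i \<and> i \<le> 2 * m - 2" for i
  have "R i \<longleftrightarrow> R j" using eq rot_neq_refl unfolding vertex_def R_def by (metis (full_types))
  moreover have "expo i = expo j"
    using eq calculation expo_bounds[of i] expo_bounds[of j] ij dvd_diff_iff(2)[of "expo i" "expo j"]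
    by (cases "R i") (simp_all add: vertex_def rot_eq_iff refl_eq_iff flip: R_def)
  ultimately show "i = j"
    using ij m_ge_4 unfolding R_def expo_def by (auto split: if_splits)
qed

lemma vertex_image: "vertex ` {..<vertex_count} = nc_vertices G"
proof
  show "vertex ` {..<vertex_count} \<subseteq> nc_vertices G"
    using rot_vertex refl_vertex expo_rot by (auto simp: vertex_def)
  show "nc_vertices G \<subseteq> vertex ` {..<vertex_count}"
  proof
    fix x assume x: "x \<in> nc_vertices G"
    then have "x \<in> carrier G" by (simp add: nc_vertices_def)
    then obtain i where i: "x = rot i \<or> x = rfl i" using carrier_cases by blast
    define t where "t = i mod (2 * int m)"
    have t: "0 \<le> t" "t < 2 * int m" using m_pos by (simp_all add: t_def)
    have "rot i = rot t" unfolding t_def using rot_mod[of i] by (simp add: ord_a)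
    with i consider "x = rot t" | "x = rfl t" by auto
    then show "x \<in> vertex ` {..<vertex_count}"
    proof cases
      case 1
      then have "\<not> int m dvd t" using x rot_vertex by simp
      then have "t \<noteq> 0" "t \<noteq> int m" by auto
      \<comment> \<open>Inverse of \<open>expo\<close> on rotations: \<open>nat t - 1\<close> undoes
        the shift past \<open>m\<close>.\<close>
      then have "x = vertex (if t = 1 then 0 else if t < int m then nat t else nat t - 1)"
        using 1 t m_ge_4 by (auto simp: vertex_def expo_def of_nat_diff)
      then show ?thesis using t m_ge_4 by (auto intro!: image_eqI)
    next
      case 2
      then have "x = vertex (if t = 0 then 1 else nat t + (2 * m - 2))"
        using t m_ge_4 by (auto simp: vertex_def expo_def of_nat_diff)
      then show ?thesis using t m_ge_4 by (auto intro!: image_eqI)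
    qed
  qed
qed

text \<open>Only two reflections need arithmetic: they commute iff their exponents agree modulo
  \<open>m\<close>, that is, iff their part numbers agree.\<close>

lemma nc_dist_vertex:
  assumes i: "i < vertex_count" and j: "j < vertex_count"
  shows "nc_dist G (vertex i) (vertex j) = multipartite_dist (pair_part (2 * m - 2) m) i j"
proof -
  define R where "R i \<longleftrightarrow> i = 0 \<or> 2 \<le> i \<and> i \<le> 2 * m - 2" for i
  have part: "pair_part (2 * m - 2) m i = 0 \<longleftrightarrow> R i" for i
    by (auto simp: pair_part_def R_def)
  have eq: "vertex i = vertex j \<longleftrightarrow> i = j" using vertex_inj i j by (auto dest: inj_onD)
  consider "R i" "R j" | "R i" "\<not> R j" | "\<not> R i" "R j" | "\<not> R i" "\<not> R j" by blast
  then show ?thesis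
  proof cases
    case 1
    then have "nc_dist G (vertex i) (vertex j) = (if vertex i = vertex j then 0 else 2)"
      using expo_rot[of i] expo_rot[of j] by (simp add: vertex_def nc_dist_rot_rot flip: R_def)
    then show ?thesis using 1 part[of i] part[of j] eq by (simp add: multipartite_dist_def)
  next
    case 2
    then have "nc_dist G (vertex i) (vertex j) = 1"
      using expo_rot[of i] by (simp add: vertex_def nc_dist_rot_refl flip: R_def)
    then show ?thesis using 2 part[of i] part[of j] by (auto simp: multipartite_dist_def)
  next
    case 3
    then have "nc_dist G (vertex i) (vertex j) = 1"
      using expo_rot[of j] by (simp add: vertex_def nc_dist_rot_refl flip: R_def)
    then show ?thesis using 3 part[of i] part[of j] by (auto simp: multipartite_dist_def)
  next
    case 4
    then have "nc_dist G (vertex i) (vertex j)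
      = (if vertex i = vertex j then 0 else if int m dvd expo i - expo j then 2 else 1)"
      unfolding vertex_def by (simp add: nc_dist_refl_refl flip: R_def)
    moreover have "int m dvd expo i - expo j \<longleftrightarrow> pair_part (2 * m - 2) m i = pair_part (2 * m - 2) m j"
    proof -
      have "int m dvd expo i - expo j
        \<longleftrightarrow> expo i = expo j \<or> expo i = expo j + int m \<or> expo j = expo i + int m"
        by (rule dvd_diff_iff(1)) (use expo_bounds i j in auto)
      also have "\<dots> \<longleftrightarrow> pair_part (2 * m - 2) m i = pair_part (2 * m - 2) m j"
        using pair_part_expo[OF i 4(1)[unfolded R_def]] pair_part_expo[OF j 4(2)[unfolded R_def]]
          expo_bounds[OF i] expo_bounds[OF j] by (simp flip: of_nat_eq_iff[where 'a = int]) linarith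
      finally show ?thesis .
    qed
    ultimately show ?thesis using eq by (simp add: multipartite_dist_def)
  qed
qed

lemma char_poly_nc_distance_matrix:
  assumes "distinct vs" "set vs = nc_vertices G"
  shows "char_poly (nc_distance_matrix G vs) =
    [:4 * real m * (real m - 2), - 6 * (real m - 1), 1:] * ([:2, 1:] ^ (3 * m - 3) * [:0, 1:] ^ (m - 1))"
proof -
  define ws where "ws = map vertex [0..<vertex_count]"
  have "distinct ws" using vertex_inj by (simp add: ws_def distinct_map lessThan_atLeast0)
  moreover have "set ws = nc_vertices G" using vertex_image by (simp add: ws_def lessThan_atLeast0)
  ultimately have "char_poly (nc_distance_matrix G vs) = char_poly (nc_distance_matrix G ws)"
    unfolding nc_distance_matrix_def using assms
    by (intro char_poly_reindex[where d = "\<lambda>u v. real (nc_dist G u v)"]) simp_all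
  also have "nc_distance_matrix G ws = mat vertex_count vertex_count
      (\<lambda>(i, j). real (multipartite_dist (pair_part (2 * m - 2) m) i j))"
    unfolding nc_distance_matrix_def
    by (rule eq_matI) (simp_all add: ws_def nc_dist_vertex)
  also have "char_poly \<dots> = [:2 * real m * (real (2 * m - 2) - 2), - (2 * real (2 * m - 2) + 2 * real m - 2), 1:]
      * ([:2, 1:] ^ (2 * m - 2 + m - 1) * [:0, 1:] ^ (m - 1))"
    by (rule char_poly_multipartite) (use m_ge_4 in auto)
  also have "2 * m - 2 + m - 1 = 3 * m - 3" using m_ge_4 by auto
  also have "[:2 * real m * (real (2 * m - 2) - 2), - (2 * real (2 * m - 2) + 2 * real m - 2), 1:]
      = [:4 * real m * (real m - 2), - 6 * (real m - 1), 1:]"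
    using m_ge_4 by (simp add: of_nat_diff algebra_simps)
  finally show ?thesis .
qed

end

theorem theorem4p1:
  fixes G :: "('g, 'c) monoid_scheme" and a b :: 'g and n :: nat and vs :: "'g list"
  assumes "n \<ge> 4"
    and "group G"
    and "a \<in> carrier G" and "b \<in> carrier G"
    and "generate G {a, b} = carrier G"
    and "a [^]\<^bsub>G\<^esub> ((2::nat) ^ (n - 1)) = \<one>\<^bsub>G\<^esub>"
    and "b [^]\<^bsub>G\<^esub> (2::nat) = \<one>\<^bsub>G\<^esub>"
    and "b \<otimes>\<^bsub>G\<^esub> a \<otimes>\<^bsub>G\<^esub> inv\<^bsub>G\<^esub> b = a [^]\<^bsub>G\<^esub> ((2::nat) ^ (n - 2) - 1)"
    and "finite (carrier G)" and "card (carrier G) = 2 ^ n"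
    and "distinct vs" and "set vs = nc_vertices G"
  shows "char_poly (nc_distance_matrix G vs) =
      [:2, 1:] ^ (3 * 2 ^ (n - 2) - 3)
    * [:0, 1:] ^ (2 ^ (n - 2) - 1)
    * [:- (3 * (2 ^ (n - 2) - 1) + sqrt (5 * (2 ^ (n - 2))\<^sup>2 - 10 * 2 ^ (n - 2) + 9)), 1:]
    * [:- (3 * (2 ^ (n - 2) - 1) - sqrt (5 * (2 ^ (n - 2))\<^sup>2 - 10 * 2 ^ (n - 2) + 9)), 1:]"
proof -
  interpret group G by fact
  let ?m = "2 ^ (n - 2) :: nat"
  have pow: "2 ^ (n - 1) = 2 * ?m" "2 ^ n = 4 * ?m"
    using \<open>n \<ge> 4\<close> power_add[of "2::nat" 1 "n - 2"] power_add[of "2::nat" 2 "n - 2"]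
    by (simp_all add: Suc_diff_Suc numeral_2_eq_2)
  interpret quasidihedral G a b ?m
  proof
    show "\<exists>e\<ge>2. ?m = 2 ^ e" using \<open>n \<ge> 4\<close> by (intro exI[of _ "n - 2"]) simp
    show "b \<otimes>\<^bsub>G\<^esub> b = \<one>\<^bsub>G\<^esub>" using assms(4,7) by (simp add: numeral_2_eq_2)
  qed (use assms pow in simp_all)
  define M :: real where "M = 2 ^ (n - 2)"
  have M: "real ?m = M" by (simp add: M_def)
  have "M \<ge> 4" unfolding M[symmetric] using of_nat_mono[OF m_ge_4, where 'a = real] by simp
  \<comment> \<open>This is the radicand minus 9, so the square root squares back to the
    radicand.\<close>
  then have "0 \<le> 5 * M * (M - 2)" by simp
  then have nonneg: "0 \<le> 5 * M\<^sup>2 - 10 * M + 9" by (simp add: power2_eq_square algebra_simps)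
  \<comment> \<open>The roots have sum \<open>6 * (M - 1)\<close> and product
    \<open>9 * (M - 1)^2 - s^2 = 4 * M * (M - 2)\<close>, the trace and determinant of the
    quotient.\<close>
  have quad: "[:- (3 * (M - 1) + s), 1:] * [:- (3 * (M - 1) - s), 1:] = [:4 * M * (M - 2), - 6 * (M - 1), 1:]"
    if "s * s = 5 * M\<^sup>2 - 10 * M + 9" for s
    using that by (simp add: algebra_simps power2_eq_square)
  show ?thesis
    unfolding char_poly_nc_distance_matrix[OF assms(11,12)] M M_def[symmetric]
    using quad[of "sqrt (5 * M\<^sup>2 - 10 * M + 9)"] nonneg by (simp only: mult_ac real_sqrt_mult_self abs_of_nonneg)
qed

end
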